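(* Let $M=\mathbb E[A]$ be the mean matrix of a weakly assortative block model with blocks $S_1,\dots,S_K$ partitioning $[n]$, $|S_k|=n_k$, within-block probabilities $p_k$ and between-block probabilities $q_{k\ell}$. For some $I\subset[K]$, to be determined, consider a solution of the form $$X=\sum_{k\in I}\sum_{\ell\in I}\alpha_{k\ell}E_{S_kS_\ell}+\sum_{k\notin I}\big[\beta_kE_{S_k}+(1-\beta_k)I_{S_k}\big],\qquad \alpha_{k\ell}=\alpha_{\ell k},\tag{$*$}$$ with $\alpha_{kk}=1$ for $k\in I$ and $\beta_k\in[0,1)$ for $k\notin I$. Then the following holds: (a) Assume that the maximum of $q_{k\ell}$ over $k\ne\ell$ is attained at a unique unordered pair $\{k_0,\ell_0\}$, and let $I:=\{k:\ p_k\ge q_{k_0\ell_0}\}$. Furthermore, let $m:=\min_kn_k$, $\xi_k:=n_k/m$ and $$\alpha^*_{k_0\ell_0}:=\frac1{2\xi_{k_0}\xi_{\ell_0}}\Big[\Big(1-\frac1m\Big)\sum_{k\notin I}\xi_k-\sum_{k\in I}\xi_k(\xi_k-1)\Big].$$ If $\alpha^*_{k_0\ell_0}\in[0,1]$, then SDP-$2'$ applied with input matrix $M$ and $m=\min_kn_k$ has $( * )$ as a solution (maximizer), with, for $k\ne\ell$ in $I$, $\alpha_{k\ell}=\alpha^*_{k_0\ell_0}$ if $\{k,\ell\}=\{k_0,\ell_0\}$ and $\alpha_{k\ell}=0$ otherwise, and with $\beta_k=0$ for all $k\notin I$. (b) Assume that the block model is balanced ($n_k=m=n/K$ for all $k$),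 and let $I^c:=[K]\setminus I=\{k:\ p_k<q_{k_0\ell_0}\}$, where $I$ and the unique maximizing pair $\{k_0,\ell_0\}$ are as in (a). If $|I^c|\le2$, then the conclusion of (a) holds with $\alpha^*_{k_0\ell_0}=\frac12(1-1/m)|I^c|$. (c) Assume that the block model is balanced and weakly but not strongly assortative. Then the solution set of SDP-$2'$ with input $M$ is not equal to $\{X_0\}$, where $X_0=\sum_kE_{S_k}$ is the true cluster matrix.
   Context: **Block model mean.** $\Psi\in[0,1]^{K\times K}$ is symmetric with $p_k:=\Psi_{kk}$ and $q_{k\ell}:=\Psi_{k\ell}$, $k\neq\ell$. The mean matrix $M\in\mathbb R^{n\times n}$ is block constant: $M_{ij}=\Psi_{k\ell}$ for all $i\in S_k,\ j\in S_\ell$ (including the diagonal). Let $q^*_k:=\max_{\ell\ne k}q_{k\ell}$. The model is *weakly assortative* if $p_k>q^*_k$ for all $k$, and *strongly assortative* if $\min_kp_k>\max_kq^*_k$. **Notation.** $E_{S_kS_\ell}\in\{0,1\}^{n\times n}$ is the indicator matrix of $S_k\times S_\ell\subset[n]^2$, $E_{S_k}:=E_{S_kS_k}$, and $I_{S_k}$ is the $n\times n$ identity matrix with the entries outside $S_k\times S_k$ set to zero. $E_n$ is the $n\times n$ all-ones matrix, $\mathbf 1_n$ the all-ones vector, $\langle B,X\rangle=\mathrm{tr}(BX)$. **SDP-$2'$ with input $B$ and parameter $m$:** maximize $\langle B,X\rangle$ over symmetric $X\in\mathbb R^{n\times n}$ subject to $\langle E_n,X\rangle=mn$, $\mathrm{diag}(X)=\mathbf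 1_n$, $X\succeq0$ (positive semidefinite), $X\ge0$ (entrywise). In the balanced case $m=n/K$.
   Formalization: Part (c) is stated only for block size m ≥ 2; for m = 1 (all blocks singletons) the identity matrix X_0 is the only feasible point of SDP-2', so the solution set equals {X_0} and (c) is false as written. *)

theory Defs
  imports "HOL-Analysis.Analysis"
begin

text \<open>
  Vertices \<open>[n]\<close> are the finite type \<open>'n\<close>, block labels \<open>[K]\<close> the finite type \<open>'k\<close>, so that
  \<open>n = CARD('n)\<close> and \<open>K = CARD('k)\<close>; the blocks are \<open>S :: 'k \<Rightarrow> 'n set\<close>.
\<close>

subsection \<open>Block model\<close>

definition is_block_partition :: "('k::finite \<Rightarrow> 'n::finite set) \<Rightarrow> bool" where
  "is_block_partition S \<longleftrightarrow>
     disjoint_family S \<and> (\<Union>k. S k) = UNIV \<and> (\<forall>k. S k \<noteq> {})"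

definition is_connectivity :: "real ^ 'k ^ 'k::finite \<Rightarrow> bool" where
  "is_connectivity \<Psi> \<longleftrightarrow> transpose \<Psi> = \<Psi> \<and> (\<forall>k l. \<Psi> $ k $ l \<in> {0..1})"

text \<open>Diagonal entries of \<open>M\<close> also carry the within-block probability.\<close>
definition is_block_mean ::
  "('k::finite \<Rightarrow> 'n::finite set) \<Rightarrow> real ^ 'k ^ 'k \<Rightarrow> real ^ 'n ^ 'n \<Rightarrow> bool" where
  "is_block_mean S \<Psi> M \<longleftrightarrow>
     (\<forall>k l. \<forall>i \<in> S k. \<forall>j \<in> S l. M $ i $ j = \<Psi> $ k $ l)"

text \<open>The maxima over \<open>l \<noteq> k\<close> below range over nonempty sets only if \<open>CARD('k) \<ge> 2\<close>.\<close>
definition qstar :: "real ^ 'k ^ 'k::finite \<Rightarrow> 'k \<Rightarrow> real" where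
  "qstar \<Psi> k = Max {\<Psi> $ k $ l | l. l \<noteq> k}"

definition weakly_assortative :: "real ^ 'k ^ 'k::finite \<Rightarrow> bool" where
  "weakly_assortative \<Psi> \<longleftrightarrow> (\<forall>k. \<Psi> $ k $ k > qstar \<Psi> k)"

definition strongly_assortative :: "real ^ 'k ^ 'k::finite \<Rightarrow> bool" where
  "strongly_assortative \<Psi> \<longleftrightarrow>
     Min (range (\<lambda>k. \<Psi> $ k $ k)) > Max (range (qstar \<Psi>))"

definition unique_max_pair :: "real ^ 'k ^ 'k::finite \<Rightarrow> 'k \<Rightarrow> 'k \<Rightarrow> bool" where
  "unique_max_pair \<Psi> k0 l0 \<longleftrightarrow> k0 \<noteq> l0 \<and>
     {{k, l} | k l. k \<noteq> l \<and> \<Psi> $ k $ l = Max {\<Psi> $ i $ j | i j. i \<noteq> j}} = {{k0, l0}}"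

definition min_block :: "('k::finite \<Rightarrow> 'n::finite set) \<Rightarrow> nat" where
  "min_block S = Min (range (\<lambda>k. card (S k)))"

definition balanced :: "('k::finite \<Rightarrow> 'n::finite set) \<Rightarrow> bool" where
  "balanced S \<longleftrightarrow> (\<forall>k. real (card (S k)) = real CARD('n) / real CARD('k))"

subsection \<open>The semidefinite program\<close>

definition psd :: "real ^ 'n ^ 'n::finite \<Rightarrow> bool" where
  "psd X \<longleftrightarrow> transpose X = X \<and> (\<forall>x. 0 \<le> x \<bullet> (X *v x))"

definition mat_inner :: "real ^ 'n ^ 'n::finite \<Rightarrow> real ^ 'n ^ 'n \<Rightarrow> real" where
  "mat_inner B X = trace (B ** X)"

definition all_ones :: "real ^ 'n ^ 'n::finite" where
  "all_ones = (\<chi> i j. 1)"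

definition sdp2_feasible :: "real \<Rightarrow> real ^ 'n ^ 'n::finite \<Rightarrow> bool" where
  "sdp2_feasible m X \<longleftrightarrow>
     transpose X = X \<and>
     mat_inner all_ones X = m * real CARD('n) \<and>
     (\<forall>i. X $ i $ i = 1) \<and>
     psd X \<and>
     (\<forall>i j. 0 \<le> X $ i $ j)"

definition sdp2_solutions :: "real ^ 'n ^ 'n::finite \<Rightarrow> real \<Rightarrow> (real ^ 'n ^ 'n) set" where
  "sdp2_solutions B m =
     {X. sdp2_feasible m X \<and> (\<forall>Y. sdp2_feasible m Y \<longrightarrow> mat_inner B Y \<le> mat_inner B X)}"

subsection \<open>Block matrices and the ansatz\<close>

definition block_E :: "'n set \<Rightarrow> 'n set \<Rightarrow> real ^ 'n ^ 'n::finite" where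
  "block_E A B = (\<chi> i j. if i \<in> A \<and> j \<in> B then 1 else 0)"

definition block_I :: "'n set \<Rightarrow> real ^ 'n ^ 'n::finite" where
  "block_I A = (\<chi> i j. if i = j \<and> i \<in> A then 1 else 0)"

definition true_cluster :: "('k::finite \<Rightarrow> 'n::finite set) \<Rightarrow> real ^ 'n ^ 'n" where
  "true_cluster S = (\<Sum>k\<in>UNIV. block_E (S k) (S k))"

definition ansatz ::
  "('k::finite \<Rightarrow> 'n::finite set) \<Rightarrow> 'k set \<Rightarrow> ('k \<Rightarrow> 'k \<Rightarrow> real) \<Rightarrow> ('k \<Rightarrow> real) \<Rightarrow> real ^ 'n ^ 'n" where
  "ansatz S I \<alpha> \<beta> =
     (\<Sum>k\<in>I. \<Sum>l\<in>I. \<alpha> k l *\<^sub>R block_E (S k) (S l)) +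
     (\<Sum>k\<in>-I. \<beta> k *\<^sub>R block_E (S k) (S k) + (1 - \<beta> k) *\<^sub>R block_I (S k))"

definition ansatz_coeffs :: "'k::finite set \<Rightarrow> ('k \<Rightarrow> 'k \<Rightarrow> real) \<Rightarrow> ('k \<Rightarrow> real) \<Rightarrow> bool" where
  "ansatz_coeffs I \<alpha> \<beta> \<longleftrightarrow>
     (\<forall>k\<in>I. \<forall>l\<in>I. \<alpha> k l = \<alpha> l k) \<and> (\<forall>k\<in>I. \<alpha> k k = 1) \<and> (\<forall>k. k \<notin> I \<longrightarrow> \<beta> k \<in> {0..<1})"

definition high_blocks :: "real ^ 'k ^ 'k::finite \<Rightarrow> 'k \<Rightarrow> 'k \<Rightarrow> 'k set" where
  "high_blocks \<Psi> k0 l0 = {k. \<Psi> $ k $ k \<ge> \<Psi> $ k0 $ l0}"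

definition rel_size :: "('k::finite \<Rightarrow> 'n::finite set) \<Rightarrow> 'k \<Rightarrow> real" where
  "rel_size S k = real (card (S k)) / real (min_block S)"

definition alpha_star ::
  "('k::finite \<Rightarrow> 'n::finite set) \<Rightarrow> real ^ 'k ^ 'k \<Rightarrow> 'k \<Rightarrow> 'k \<Rightarrow> real" where
  "alpha_star S \<Psi> k0 l0 =
     1 / (2 * rel_size S k0 * rel_size S l0) *
     ((1 - 1 / real (min_block S)) * (\<Sum>k\<in>- high_blocks \<Psi> k0 l0. rel_size S k)
       - (\<Sum>k\<in>high_blocks \<Psi> k0 l0. rel_size S k * (rel_size S k - 1)))"

text \<open>
  SDP-\<open>2'\<close> with input \<open>M\<close> and parameter \<open>min_block S\<close> is maximized by the ansatz whose only
  nonzero off-diagonal coefficient on \<open>I\<close> is the value \<open>a\<close> at the pair \<open>{k0, l0}\<close>, with \<open>\<beta> = 0\<close>.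
\<close>
definition ansatz_solution ::
  "('k::finite \<Rightarrow> 'n::finite set) \<Rightarrow> real ^ 'k ^ 'k \<Rightarrow> real ^ 'n ^ 'n \<Rightarrow> 'k \<Rightarrow> 'k \<Rightarrow> real \<Rightarrow> bool" where
  "ansatz_solution S \<Psi> M k0 l0 a \<longleftrightarrow>
     (let I = high_blocks \<Psi> k0 l0 in
      \<exists>\<alpha> \<beta>. ansatz_coeffs I \<alpha> \<beta> \<and>
        (\<forall>k\<in>I. \<forall>l\<in>I. k \<noteq> l \<longrightarrow> \<alpha> k l = (if {k, l} = {k0, l0} then a else 0)) \<and>
        (\<forall>k. k \<notin> I \<longrightarrow> \<beta> k = 0) \<and>
        ansatz S I \<alpha> \<beta> \<in> sdp2_solutions M (real (min_block S)))"

subsection \<open>Singleton blocks\<close>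

text \<open>
  With \<open>m = 1\<close> the identity matrix is the only feasible point, whatever the input matrix, and it is
  the true cluster matrix. Hence a nonuniqueness statement about a balanced model needs \<open>m \<ge> 2\<close>.
\<close>
lemma singleton_blocks_unique_solution:
  fixes S :: "'k::finite \<Rightarrow> 'n::finite set"
  assumes part: "is_block_partition S" and one: "\<And>k. card (S k) = 1"
  shows "sdp2_solutions B 1 = {true_cluster S}"
proof -
  have tc: "true_cluster S = mat 1"
  proof -
    have "true_cluster S $ i $ j = (mat 1 :: real ^ 'n ^ 'n) $ i $ j" for i j
    proof -
      obtain k where k: "i \<in> S k"
        using part unfolding is_block_partition_def by blast
      have Sk: "S k = {i}"
        using one[of k] k by (metis card_1_singletonE singletonD)
      have other: "i \<notin> S l" if "l \<noteq> k" for l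
        using part k that unfolding is_block_partition_def disjoint_family_on_def by blast
      have "true_cluster S $ i $ j = (\<Sum>l\<in>UNIV. if l = k then (if j = i then 1 else 0) else 0)"
        unfolding true_cluster_def sum_component block_E_def
        by (intro sum.cong refl) (use Sk other in auto)
      then show ?thesis by (simp add: mat_def)
    qed
    then show ?thesis by (simp add: vec_eq_iff)
  qed
  have total: "mat_inner all_ones X = (\<Sum>i\<in>UNIV. \<Sum>j\<in>UNIV. X $ j $ i)" for X :: "real ^ 'n ^ 'n"
    by (simp add: mat_inner_def all_ones_def trace_def matrix_matrix_mult_def)
  have uniq: "X = mat 1" if f: "sdp2_feasible 1 X" for X :: "real ^ 'n ^ 'n"
  proof -
    have nn: "\<And>i j. 0 \<le> X $ i $ j" and d: "\<And>i. X $ i $ i = 1"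
      and s: "(\<Sum>i\<in>UNIV. \<Sum>j\<in>UNIV. X $ j $ i) = real CARD('n)"
      using f unfolding sdp2_feasible_def total by simp_all
    have split: "(\<Sum>j\<in>UNIV. X $ j $ i) = 1 + (\<Sum>j\<in>UNIV - {i}. X $ j $ i)" for i
      by (subst sum.remove[of _ i]) (simp_all add: d)
    have "(\<Sum>i\<in>UNIV. \<Sum>j\<in>UNIV - {i}. X $ j $ i) = 0"
    proof -
      have "(\<Sum>i\<in>UNIV. \<Sum>j\<in>UNIV. X $ j $ i) = (\<Sum>i\<in>UNIV. 1 + (\<Sum>j\<in>UNIV - {i}. X $ j $ i))"
        by (intro sum.cong refl split)
      then show ?thesis using s by (simp add: sum.distrib)
    qed
    then have z: "(\<Sum>j\<in>UNIV - {i}. X $ j $ i) = 0" for i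
      using sum_nonneg_0[OF finite, of UNIV "\<lambda>i. \<Sum>j\<in>UNIV - {i}. X $ j $ i" i] nn
      by (simp add: sum_nonneg)
    have "X $ j $ i = 0" if "j \<noteq> i" for i j
      by (rule sum_nonneg_0[OF _ _ z[of i]]) (use that nn in simp_all)
    then show ?thesis by (simp add: vec_eq_iff mat_def d)
  qed
  have feas: "sdp2_feasible 1 (mat 1 :: real ^ 'n ^ 'n)"
  proof -
    have "(\<Sum>i\<in>UNIV. \<Sum>j\<in>UNIV. (mat 1 :: real ^ 'n ^ 'n) $ j $ i) = real CARD('n)"
      by (simp add: mat_def)
    moreover have "\<forall>i. (mat 1 :: real ^ 'n ^ 'n) $ i $ i = 1" "\<forall>i j. 0 \<le> (mat 1 :: real ^ 'n ^ 'n) $ i $ j"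
      by (simp_all add: mat_def)
    ultimately show ?thesis
      unfolding sdp2_feasible_def psd_def total by (simp add: transpose_mat)
  qed
  show ?thesis
    unfolding sdp2_solutions_def tc
  proof (intro equalityI subsetI)
    fix X assume "X \<in> {X. sdp2_feasible 1 X \<and> (\<forall>Y. sdp2_feasible 1 Y \<longrightarrow> mat_inner B Y \<le> mat_inner B X)}"
    then show "X \<in> {mat 1}" using uniq[of X] by blast
  next
    fix X :: "real ^ 'n ^ 'n" assume "X \<in> {mat 1}"
    then have X: "X = mat 1" by (rule singletonD)
    have "mat_inner B Y \<le> mat_inner B (mat 1)" if "sdp2_feasible 1 Y" for Y
      unfolding uniq[OF that] by (rule order_refl)
    then show "X \<in> {X. sdp2_feasible 1 X \<and> (\<forall>Y. sdp2_feasible 1 Y \<longrightarrow> mat_inner B Y \<le> mat_inner B X)}"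
      unfolding X using feas by blast
  qed
qed

end

theory Submission
  imports Defs
begin

text \<open>
  Let \<open>q\<close> be the largest between-block probability. Since the total sum of a feasible \<open>Y\<close> is
  prescribed, maximizing \<open>\<langle>M, Y\<rangle>\<close> is the same as maximizing \<open>\<Sum>\<^sub>i\<^sub>j (M\<^sub>i\<^sub>j - q) Y\<^sub>i\<^sub>j\<close>, and
  \<open>0 \<le> Y\<^sub>i\<^sub>j \<le> 1\<close> with unit diagonal. Entry by entry the best choice is \<open>1\<close> on the blocks with
  \<open>p\<^sub>k \<ge> q\<close> and \<open>0\<close> elsewhere off the diagonal, except on the blocks \<open>{k0, l0}\<close>, where the
  coefficient of \<open>Y\<^sub>i\<^sub>j\<close> vanishes and which therefore absorb the sum constraint at no cost.
  For the last part, the mass of one within-block with \<open>p\<^sub>k \<le> q\<close> is moved to such a pair: this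
  does not decrease the objective.
\<close>

section \<open>Entries of the block matrices\<close>

definition block_of :: "('k \<Rightarrow> 'n set) \<Rightarrow> 'n \<Rightarrow> 'k" where
  "block_of S i = (THE k. i \<in> S k)"

lemma symmetric_entry:
  assumes "transpose X = X"
  shows "X $ j $ i = X $ i $ j"
  using arg_cong[OF assms, of "\<lambda>Y. Y $ i $ j"] by (simp add: transpose_def)

lemma mem_block_iff:
  assumes "is_block_partition S"
  shows "i \<in> S k \<longleftrightarrow> block_of S i = k"
proof -
  have uniq: "l = k" if "i \<in> S k" "i \<in> S l" for k l
    using assms that unfolding is_block_partition_def disjoint_family_on_def by blast
  obtain k' where k': "i \<in> S k'"
    using assms unfolding is_block_partition_def by blast
  then have "block_of S i = k'"
    unfolding block_of_def by (intro the_equality uniq)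
  then show ?thesis using k' uniq by blast
qed

lemma sum_over_blocks:
  fixes S :: "'k::finite \<Rightarrow> 'n::finite set" and f :: "'n \<Rightarrow> 'b::comm_monoid_add"
  assumes "is_block_partition S"
  shows "(\<Sum>i\<in>{i. block_of S i \<in> J}. f i) = (\<Sum>k\<in>J. \<Sum>i\<in>S k. f i)"
proof -
  have "{i. block_of S i \<in> J} = (\<Union>k\<in>J. S k)"
    by (auto simp: mem_block_iff[OF assms])
  moreover have "(\<Sum>i\<in>(\<Union>k\<in>J. S k). f i) = (\<Sum>k\<in>J. \<Sum>i\<in>S k. f i)"
    using assms by (intro sum.UNION_disjoint) (auto simp: is_block_partition_def disjoint_family_on_def)
  ultimately show ?thesis by simp
qed

lemma block_mean_entry:
  assumes "is_block_partition S" "is_block_mean S \<Psi> M"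
  shows "M $ i $ j = \<Psi> $ block_of S i $ block_of S j"
  using assms(2) mem_block_iff[OF assms(1)] unfolding is_block_mean_def by blast

lemma true_cluster_entry:
  fixes S :: "'k::finite \<Rightarrow> 'n::finite set"
  assumes "is_block_partition S"
  shows "true_cluster S $ i $ j = (if block_of S i = block_of S j then 1 else 0)"
proof -
  have "true_cluster S $ i $ j = (\<Sum>k\<in>UNIV. if block_of S i = k
      then (if block_of S i = block_of S j then 1 else 0) else 0)"
    unfolding true_cluster_def sum_component block_E_def
    by (intro sum.cong refl) (auto simp: mem_block_iff[OF assms])
  then show ?thesis by simp
qed

text \<open>With \<open>\<beta> = 0\<close> the second sum keeps only the identities of the blocks
  outside \<open>I\<close>, and disjointness of the blocks leaves at most one nonzero term in either
  sum.\<close>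

lemma ansatz_entry:
  fixes S :: "'k::finite \<Rightarrow> 'n::finite set"
  assumes "is_block_partition S"
  shows "ansatz S I \<alpha> (\<lambda>_. 0) $ i $ j =
    (if block_of S i \<in> I \<and> block_of S j \<in> I then \<alpha> (block_of S i) (block_of S j)
     else if i = j then 1 else 0)"
proof -
  let ?b = "block_of S"
  have inner: "(\<Sum>l\<in>I. \<alpha> k l * (if ?b i = k \<and> ?b j = l then 1 else 0)) =
      (if ?b i = k then (if ?b j \<in> I then \<alpha> (?b i) (?b j) else 0) else 0)" for k
  proof -
    \<comment> \<open>The value is rewritten in terms of \<open>?b i\<close> and
      \<open>?b j\<close>, so that it no longer depends on the summation index and the sum collapses
      to its one matching term.\<close>
    have "(\<Sum>l\<in>I. \<alpha> k l * (if ?b i = k \<and> ?b j = l then 1 else 0)) =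
        (\<Sum>l\<in>I. if ?b j = l then (if ?b i = k then \<alpha> (?b i) (?b j) else 0) else 0)"
      by (intro sum.cong) auto
    then show ?thesis by (simp)
  qed
  have diag: "(\<Sum>k\<in>-I. if i = j \<and> ?b i = k then 1 else 0) = (if i = j \<and> ?b i \<notin> I then 1 else 0 :: real)"
  proof -
    have "(\<Sum>k\<in>-I. if i = j \<and> ?b i = k then 1 else 0) =
        (\<Sum>k\<in>-I. if ?b i = k then (if i = j then 1 else 0) else 0 :: real)"
      by (intro sum.cong) auto
    then show ?thesis by simp
  qed
  have "ansatz S I \<alpha> (\<lambda>_. 0) $ i $ j =
      (\<Sum>k\<in>I. \<Sum>l\<in>I. \<alpha> k l * (if ?b i = k \<and> ?b j = l then 1 else 0)) +
      (\<Sum>k\<in>-I. if i = j \<and> ?b i = k then 1 else 0)"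
    by (simp add: ansatz_def sum_component block_E_def block_I_def mem_block_iff[OF assms])
  then show ?thesis
    unfolding inner diag by auto
qed

section \<open>Quadratic form and feasibility of the candidate\<close>

definition pair_coeff :: "'k \<Rightarrow> 'k \<Rightarrow> real \<Rightarrow> 'k \<Rightarrow> 'k \<Rightarrow> real" where
  "pair_coeff k0 l0 a k l = (if k = l then 1 else if {k, l} = {k0, l0} then a else 0)"

text \<open>This identity serves twice: \<open>y = 1\<close> gives the total sum of the entries, a
  general \<open>y\<close> gives positive semidefiniteness. Apart from the identity on the blocks
  outside \<open>I\<close>, the form sees \<open>y\<close> only through its block sums.\<close>

lemma pair_ansatz_quadratic_form:
  fixes S :: "'k::finite \<Rightarrow> 'n::finite set" and y :: "'n \<Rightarrow> real"
  assumes part: "is_block_partition S" and kl: "k0 \<in> I" "l0 \<in> I" "k0 \<noteq> l0"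
  shows "(\<Sum>i\<in>UNIV. \<Sum>j\<in>UNIV. ansatz S I (pair_coeff k0 l0 a) (\<lambda>_. 0) $ i $ j * (y i * y j)) =
    (\<Sum>k\<in>I. (\<Sum>i\<in>S k. y i)\<^sup>2) + 2 * a * ((\<Sum>i\<in>S k0. y i) * (\<Sum>i\<in>S l0. y i))
      + (\<Sum>k\<in>-I. \<Sum>i\<in>S k. (y i)\<^sup>2)"
proof -
  let ?b = "block_of S"
  let ?s = "\<lambda>k. \<Sum>i\<in>S k. y i"
  \<comment> \<open>\<open>?v k\<close> is \<open>y\<close> restricted to block \<open>k\<close>. In
    these terms each summand splits into products of a function of \<open>i\<close> and a function
    of \<open>j\<close>, whose double sums factor into block sums, plus the diagonal part
    \<open>?d\<close>.\<close>
  let ?v = "\<lambda>k i. if ?b i = k then y i else 0"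
  let ?d = "\<lambda>i j. if j = i then (if ?b i \<in> -I then (y i)\<^sup>2 else 0) else 0"
  have block: "(\<Sum>i\<in>UNIV. ?v k i) = ?s k" for k
    by (subst sum.inter_filter[symmetric]) (auto intro!: sum.cong simp: mem_block_iff[OF part])
  have prod: "(\<Sum>i\<in>UNIV. \<Sum>j\<in>UNIV. ?v k i * ?v l j) = ?s k * ?s l" for k l
    by (simp only: block[symmetric] sum_product)
  have entry: "ansatz S I (pair_coeff k0 l0 a) (\<lambda>_. 0) $ i $ j * (y i * y j) =
      (\<Sum>k\<in>I. ?v k i * ?v k j) + a * (?v k0 i * ?v l0 j + ?v l0 i * ?v k0 j) + ?d i j" for i j
  proof -
    have "(\<Sum>k\<in>I. ?v k i * ?v k j) =
        (\<Sum>k\<in>I. if ?b i = k then (if ?b i = ?b j then y i * y j else 0) else 0)"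
      by (intro sum.cong) auto
    also have "\<dots> = (if ?b i \<in> I \<and> ?b i = ?b j then y i * y j else 0)"
      by auto
    finally have same: "(\<Sum>k\<in>I. ?v k i * ?v k j) = (if ?b i \<in> I \<and> ?b i = ?b j then y i * y j else 0)" .
    have pair: "?v k0 i * ?v l0 j + ?v l0 i * ?v k0 j =
        (if ?b i \<noteq> ?b j \<and> {?b i, ?b j} = {k0, l0} then y i * y j else 0)"
      using kl(3) by (auto simp: doubleton_eq_iff)
    have in_I: "?b i \<in> I \<and> ?b j \<in> I" if "{?b i, ?b j} = {k0, l0}"
      using that kl by (auto simp: doubleton_eq_iff)
    consider "i = j" | "i \<noteq> j" "?b i = ?b j" | "?b i \<noteq> ?b j" "i \<noteq> j" by blast
    then show ?thesis
    proof cases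
      case 1
      then show ?thesis
        unfolding same pair ansatz_entry[OF part] pair_coeff_def by (simp add: power2_eq_square)
    next
      case 2
      then show ?thesis
        unfolding same pair ansatz_entry[OF part] pair_coeff_def by simp
    next
      case 3
      then show ?thesis
        unfolding same pair ansatz_entry[OF part] pair_coeff_def using in_I by simp
    qed
  qed
  have "(\<Sum>i\<in>UNIV. \<Sum>j\<in>UNIV. \<Sum>k\<in>I. ?v k i * ?v k j) = (\<Sum>i\<in>UNIV. \<Sum>k\<in>I. \<Sum>j\<in>UNIV. ?v k i * ?v k j)"
    by (rule sum.cong[OF refl], rule sum.swap)
  also have "\<dots> = (\<Sum>k\<in>I. \<Sum>i\<in>UNIV. \<Sum>j\<in>UNIV. ?v k i * ?v k j)"
    by (rule sum.swap)
  finally have blocks: "(\<Sum>i\<in>UNIV. \<Sum>j\<in>UNIV. \<Sum>k\<in>I. ?v k i * ?v k j) = (\<Sum>k\<in>I. (?s k)\<^sup>2)"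
    unfolding prod by (simp add: power2_eq_square)
  have "(\<Sum>i\<in>UNIV. \<Sum>j\<in>UNIV. ?d i j) = (\<Sum>i\<in>{i. ?b i \<in> -I}. (y i)\<^sup>2)"
    by (simp add: sum.If_cases)
  then have diag: "(\<Sum>i\<in>UNIV. \<Sum>j\<in>UNIV. ?d i j) = (\<Sum>k\<in>-I. \<Sum>i\<in>S k. (y i)\<^sup>2)"
    unfolding sum_over_blocks[OF part] .
  have "(\<Sum>i\<in>UNIV. \<Sum>j\<in>UNIV. a * (?v k0 i * ?v l0 j + ?v l0 i * ?v k0 j)) =
      a * ((\<Sum>i\<in>UNIV. \<Sum>j\<in>UNIV. ?v k0 i * ?v l0 j) + (\<Sum>i\<in>UNIV. \<Sum>j\<in>UNIV. ?v l0 i * ?v k0 j))"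
    by (simp only: sum_distrib_left sum.distrib distrib_left)
  also have "\<dots> = 2 * a * (?s k0 * ?s l0)"
    unfolding prod by simp
  finally have pair: "(\<Sum>i\<in>UNIV. \<Sum>j\<in>UNIV. a * (?v k0 i * ?v l0 j + ?v l0 i * ?v k0 j)) = 2 * a * (?s k0 * ?s l0)" .
  show ?thesis
    unfolding entry sum.distrib blocks pair diag ..
qed

lemma quadratic_form_eq_sum:
  fixes X :: "real ^ 'n ^ 'n::finite"
  shows "x \<bullet> (X *v x) = (\<Sum>i\<in>UNIV. \<Sum>j\<in>UNIV. X $ i $ j * (x $ i * x $ j))"
  by (simp add: inner_vec_def matrix_vector_mult_def sum_distrib_left algebra_simps)

lemma mat_inner_eq_sum:
  assumes "transpose X = X"
  shows "mat_inner B X = (\<Sum>i\<in>UNIV. \<Sum>j\<in>UNIV. B $ i $ j * X $ i $ j)"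
proof -
  have "X $ j $ i = X $ i $ j" for i j
    using assms by (rule symmetric_entry)
  then show ?thesis
    by (simp add: mat_inner_def trace_def matrix_matrix_mult_def)
qed

text \<open>The left side of \<open>total\<close> is the sum of all entries: a block in
  \<open>I\<close> contributes its squared size, a block outside \<open>I\<close> only its diagonal,
  and the pair counts twice. Only positive semidefiniteness needs an argument.\<close>

lemma pair_ansatz_feasible:
  fixes S :: "'k::finite \<Rightarrow> 'n::finite set"
  assumes part: "is_block_partition S" and kl: "k0 \<in> I" "l0 \<in> I" "k0 \<noteq> l0"
    and a: "0 \<le> a" "a \<le> 1"
    and total: "(\<Sum>k\<in>I. (real (card (S k)))\<^sup>2) + 2 * a * (real (card (S k0)) * real (card (S l0)))
      + (\<Sum>k\<in>-I. real (card (S k))) = m * real CARD('n)"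
  shows "sdp2_feasible m (ansatz S I (pair_coeff k0 l0 a) (\<lambda>_. 0))"
proof -
  let ?X = "ansatz S I (pair_coeff k0 l0 a) (\<lambda>_. 0)"
  note qf = pair_ansatz_quadratic_form[OF part kl]
  have sym: "transpose ?X = ?X"
    by (auto simp: vec_eq_iff transpose_def ansatz_entry[OF part] pair_coeff_def insert_commute)
  have "mat_inner all_ones ?X = m * real CARD('n)"
    using qf[of a "\<lambda>_. 1"] total unfolding mat_inner_eq_sum[OF sym] by (simp add: all_ones_def)
  moreover have "psd ?X"
    unfolding psd_def
  proof (intro conjI allI sym)
    fix x :: "real ^ 'n"
    define s where "s k = (\<Sum>i\<in>S k. x $ i)" for k
    \<comment> \<open>Only the blocks \<open>k0\<close> and \<open>l0\<close> interact; the other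
      squares are dropped, which leaves a form in the two variables \<open>s k0\<close> and
      \<open>s l0\<close>.\<close>
    have "{k0, l0} \<subseteq> I" using kl by simp
    then have "(\<Sum>k\<in>{k0, l0}. (s k)\<^sup>2) \<le> (\<Sum>k\<in>I. (s k)\<^sup>2)"
      by (intro sum_mono2) auto
    then have "(s k0)\<^sup>2 + (s l0)\<^sup>2 \<le> (\<Sum>k\<in>I. (s k)\<^sup>2)"
      using kl by simp
    moreover have "0 \<le> (s k0)\<^sup>2 + (s l0)\<^sup>2 + 2 * a * (s k0 * s l0)"
    proof -
      \<comment> \<open>For \<open>a\<close> in [0, 1] this is a convex combination of two
        nonnegative quantities.\<close>
      have "(s k0)\<^sup>2 + (s l0)\<^sup>2 + 2 * a * (s k0 * s l0) =
          a * (s k0 + s l0)\<^sup>2 + (1 - a) * ((s k0)\<^sup>2 + (s l0)\<^sup>2)"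
        by (simp add: power2_eq_square algebra_simps)
      then show ?thesis using a by simp
    qed
    moreover have "0 \<le> (\<Sum>k\<in>-I. \<Sum>i\<in>S k. (x $ i)\<^sup>2)"
      by (intro sum_nonneg) simp
    ultimately show "0 \<le> x \<bullet> (?X *v x)"
      unfolding quadratic_form_eq_sum qf s_def by linarith
  qed
  moreover have "?X $ i $ i = 1" "0 \<le> ?X $ i $ j" for i j
    using a by (simp_all add: ansatz_entry[OF part] pair_coeff_def)
  ultimately show ?thesis
    unfolding sdp2_feasible_def using sym by blast
qed

section \<open>Optimality by entrywise comparison\<close>

lemma psd_entry_le_one:
  fixes X :: "real ^ 'n ^ 'n::finite"
  assumes "psd X" and diag: "\<And>i. X $ i $ i = 1"
  shows "X $ i $ j \<le> 1"
proof (cases "i = j")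
  case False
  \<comment> \<open>By symmetry and the unit diagonal, the form at this vector equals
    \<open>2 - 2 * X $ i $ j\<close>.\<close>
  let ?x = "axis i 1 - axis j 1 :: real ^ 'n"
  have "X $ j $ i = X $ i $ j"
    using assms(1) unfolding psd_def by (blast intro: symmetric_entry)
  moreover have "0 \<le> ?x \<bullet> (X *v ?x)"
    using assms(1) unfolding psd_def by blast
  ultimately show ?thesis
    using diag[of i] diag[of j]
    by (simp add: matrix_vector_mult_diff_distrib inner_diff_left inner_diff_right
        inner_axis' matrix_vector_mul_component cart_eq_inner_axis[symmetric] inner_axis)
qed (simp add: diag)

text \<open>The shift by \<open>q\<close> changes the objective of every feasible matrix by the same
  amount \<open>q * (m * real CARD('n))\<close>, so a termwise comparison may be made after any
  shift.\<close>

lemma feasible_mat_inner_le: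
  fixes B X Y :: "real ^ 'n ^ 'n::finite"
  assumes X: "sdp2_feasible m X" and Y: "sdp2_feasible m Y"
    and le: "\<And>i j. (B $ i $ j - q) * Y $ i $ j \<le> (B $ i $ j - q) * X $ i $ j"
  shows "mat_inner B Y \<le> mat_inner B X"
proof -
  have eq: "(\<Sum>i\<in>UNIV. \<Sum>j\<in>UNIV. (B $ i $ j - q) * Z $ i $ j) =
      mat_inner B Z - q * (m * real CARD('n))" if "sdp2_feasible m Z" for Z :: "real ^ 'n ^ 'n"
  proof -
    have sym: "transpose Z = Z" and "mat_inner all_ones Z = m * real CARD('n)"
      using that unfolding sdp2_feasible_def by auto
    then have "(\<Sum>i\<in>UNIV. \<Sum>j\<in>UNIV. Z $ i $ j) = m * real CARD('n)"
      by (simp add: mat_inner_eq_sum all_ones_def)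
    then show ?thesis
      unfolding mat_inner_eq_sum[OF sym]
      by (simp add: left_diff_distrib sum_subtractf sum_distrib_left[symmetric])
  qed
  have "(\<Sum>i\<in>UNIV. \<Sum>j\<in>UNIV. (B $ i $ j - q) * Y $ i $ j) \<le>
      (\<Sum>i\<in>UNIV. \<Sum>j\<in>UNIV. (B $ i $ j - q) * X $ i $ j)"
    by (intro sum_mono le)
  then show ?thesis unfolding eq[OF X] eq[OF Y] by simp
qed

text \<open>The coefficient \<open>a\<close> sits on entries where \<open>M\<close> equals
  \<open>\<Psi> $ k0 $ l0\<close>, so its value does not affect the shifted objective: whenever the
  candidate is feasible, it is a maximizer.\<close>

lemma pair_ansatz_optimal:
  fixes S :: "'k::finite \<Rightarrow> 'n::finite set"
  assumes part: "is_block_partition S" and mean: "is_block_mean S \<Psi> M"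
    and sym: "transpose \<Psi> = \<Psi>"
    and max: "\<And>k l. k \<noteq> l \<Longrightarrow> \<Psi> $ k $ l \<le> \<Psi> $ k0 $ l0"
    and feas: "sdp2_feasible m (ansatz S (high_blocks \<Psi> k0 l0) (pair_coeff k0 l0 a) (\<lambda>_. 0))"
  shows "ansatz S (high_blocks \<Psi> k0 l0) (pair_coeff k0 l0 a) (\<lambda>_. 0) \<in> sdp2_solutions M m"
proof -
  let ?X = "ansatz S (high_blocks \<Psi> k0 l0) (pair_coeff k0 l0 a) (\<lambda>_. 0)"
  let ?q = "\<Psi> $ k0 $ l0"
  let ?b = "block_of S"
  have "mat_inner M Y \<le> mat_inner M ?X" if Y: "sdp2_feasible m Y" for Y
  proof (rule feasible_mat_inner_le[OF feas Y, where q = ?q])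
    fix i j
    have Y0: "0 \<le> Y $ i $ j" and Yd: "Y $ i $ i = 1"
      using Y unfolding sdp2_feasible_def by auto
    have Y1: "Y $ i $ j \<le> 1"
      using Y psd_entry_le_one unfolding sdp2_feasible_def by blast
    have entry: "M $ i $ j = \<Psi> $ ?b i $ ?b j"
      using part mean by (rule block_mean_entry)
    have swap: "\<Psi> $ l0 $ k0 = ?q"
      using sym by (rule symmetric_entry)
    \<comment> \<open>On the diagonal both matrices are 1. Within a block the sign of the
      coefficient selects the bound 1 or 0. On the pair the coefficient vanishes. Between other
      blocks it is at most 0 and the candidate is 0.\<close>
    consider "i = j" | "i \<noteq> j" "?b i = ?b j" "?b i \<in> high_blocks \<Psi> k0 l0"
      | "i \<noteq> j" "?b i = ?b j" "?b i \<notin> high_blocks \<Psi> k0 l0"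
      | "?b i \<noteq> ?b j" "{?b i, ?b j} = {k0, l0}"
      | "?b i \<noteq> ?b j" "{?b i, ?b j} \<noteq> {k0, l0}"
      by blast
    then show "(M $ i $ j - ?q) * Y $ i $ j \<le> (M $ i $ j - ?q) * ?X $ i $ j"
    proof cases
      case 1
      then show ?thesis using Yd by (simp add: ansatz_entry[OF part] pair_coeff_def)
    next
      case 2
      then have "?X $ i $ j = 1" "0 \<le> M $ i $ j - ?q"
        by (auto simp: ansatz_entry[OF part] pair_coeff_def entry high_blocks_def)
      then show ?thesis using Y1 mult_left_mono by fastforce
    next
      case 3
      then have "?X $ i $ j = 0" "M $ i $ j - ?q \<le> 0"
        by (auto simp: ansatz_entry[OF part] entry high_blocks_def)
      then show ?thesis using Y0 by (simp add: mult_nonpos_nonneg)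
    next
      case 4
      then have "M $ i $ j = ?q"
        using swap by (auto simp: entry doubleton_eq_iff)
      then show ?thesis by simp
    next
      case 5
      then have "?X $ i $ j = 0" "M $ i $ j - ?q \<le> 0"
        using max by (auto simp: ansatz_entry[OF part] pair_coeff_def entry)
      then show ?thesis using Y0 by (simp add: mult_nonpos_nonneg)
    qed
  qed
  then show ?thesis unfolding sdp2_solutions_def using feas by blast
qed

section \<open>The sum constraint and \<open>alpha_star\<close>\<close>

lemma card_eq_sum_blocks:
  fixes S :: "'k::finite \<Rightarrow> 'n::finite set"
  assumes "is_block_partition S"
  shows "real CARD('n) = (\<Sum>k\<in>I. real (card (S k))) + (\<Sum>k\<in>-I. real (card (S k)))"
proof -
  have "real CARD('n) = (\<Sum>k\<in>UNIV. real (card (S k)))"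
    using sum_over_blocks[OF assms, where J = UNIV and f = "\<lambda>_. 1 :: real"] by simp
  also have "\<dots> = (\<Sum>k\<in>I. real (card (S k))) + (\<Sum>k\<in>-I. real (card (S k)))"
    by (subst sum.union_disjoint[symmetric]) (auto simp: Compl_partition)
  finally show ?thesis .
qed

lemma card_block_pos:
  fixes S :: "'k::finite \<Rightarrow> 'n::finite set"
  assumes "is_block_partition S"
  shows "0 < card (S k)"
  using assms by (simp add: is_block_partition_def card_gt_0_iff)

lemma min_block_pos:
  fixes S :: "'k::finite \<Rightarrow> 'n::finite set"
  assumes "is_block_partition S"
  shows "0 < min_block S"
  unfolding min_block_def using card_block_pos[OF assms] by (subst Min_gr_iff) auto

lemma offdiag_le_qstar:
  fixes \<Psi> :: "real ^ 'k ^ 'k::finite"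
  assumes "l \<noteq> k"
  shows "\<Psi> $ k $ l \<le> qstar \<Psi> k"
  unfolding qstar_def using assms by (intro Max_ge) auto

text \<open>The total sum of the candidate is affine in its pair coefficient, and
  \<open>alpha_star\<close> is the root of the constraint equation, written in sizes relative to the
  smallest block. Multiplying by \<open>m\<^sup>2\<close> restores absolute sizes.\<close>

lemma alpha_star_total:
  fixes S :: "'k::finite \<Rightarrow> 'n::finite set" and \<Psi> :: "real ^ 'k ^ 'k" and k0 l0 :: 'k
  assumes part: "is_block_partition S"
  defines "I \<equiv> high_blocks \<Psi> k0 l0"
  shows "(\<Sum>k\<in>I. (real (card (S k)))\<^sup>2)
      + 2 * alpha_star S \<Psi> k0 l0 * (real (card (S k0)) * real (card (S l0)))
      + (\<Sum>k\<in>-I. real (card (S k))) = real (min_block S) * real CARD('n)"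
proof -
  define m where "m = real (min_block S)"
  define n where "n k = real (card (S k))" for k
  have m: "m > 0" using min_block_pos[OF part] by (simp add: m_def)
  have n: "n k > 0" for k using card_block_pos[OF part] by (simp add: n_def)
  have "2 * alpha_star S \<Psi> k0 l0 * (n k0 * n l0) =
      m\<^sup>2 * ((1 - 1 / m) * (\<Sum>k\<in>-I. n k / m) - (\<Sum>k\<in>I. n k / m * (n k / m - 1)))"
    unfolding alpha_star_def rel_size_def I_def[symmetric] m_def[symmetric] n_def[symmetric]
    using m n[of k0] n[of l0] by (simp add: field_simps power2_eq_square)
  also have "\<dots> = m\<^sup>2 * ((1 - 1 / m) * ((\<Sum>k\<in>-I. n k) / m))
      - (\<Sum>k\<in>I. m\<^sup>2 * (n k / m * (n k / m - 1)))"
    by (simp only: right_diff_distrib sum_distrib_left sum_divide_distrib)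
  also have "m\<^sup>2 * ((1 - 1 / m) * ((\<Sum>k\<in>-I. n k) / m)) = (m - 1) * (\<Sum>k\<in>-I. n k)"
    using m by (simp add: field_simps power2_eq_square)
  also have "(\<Sum>k\<in>I. m\<^sup>2 * (n k / m * (n k / m - 1))) = (\<Sum>k\<in>I. (n k)\<^sup>2 - m * n k)"
    using m by (intro sum.cong refl) (simp add: field_simps power2_eq_square)
  also have "\<dots> = (\<Sum>k\<in>I. (n k)\<^sup>2) - m * (\<Sum>k\<in>I. n k)"
    by (simp add: sum_subtractf sum_distrib_left)
  finally show ?thesis
    unfolding card_eq_sum_blocks[OF part, of I] n_def[symmetric] m_def[symmetric]
    by (simp add: algebra_simps)
qed

lemma unique_max_pairD:
  fixes \<Psi> :: "real ^ 'k ^ 'k::finite"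
  assumes "unique_max_pair \<Psi> k0 l0" and sym: "transpose \<Psi> = \<Psi>"
  shows "k0 \<noteq> l0" and "k \<noteq> l \<Longrightarrow> \<Psi> $ k $ l \<le> \<Psi> $ k0 $ l0"
proof -
  let ?Q = "{\<Psi> $ i $ j | i j. i \<noteq> j}"
  show "k0 \<noteq> l0" using assms unfolding unique_max_pair_def by blast
  have "{k0, l0} \<in> {{k, l} | k l. k \<noteq> l \<and> \<Psi> $ k $ l = Max ?Q}"
    using assms(1) unfolding unique_max_pair_def by simp
  \<comment> \<open>Equality of unordered pairs leaves the order open; symmetry of
    \<open>\<Psi>\<close> then makes both orders give the same value.\<close>
  then have "\<Psi> $ k0 $ l0 = Max ?Q \<or> \<Psi> $ l0 $ k0 = Max ?Q"
    by (auto simp: doubleton_eq_iff)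
  then have "\<Psi> $ k0 $ l0 = Max ?Q"
    using symmetric_entry[OF sym, of l0 k0] by auto
  moreover have "finite ?Q"
    by (rule finite_subset[of _ "(\<lambda>(i, j). \<Psi> $ i $ j) ` UNIV"]) auto
  ultimately show "\<Psi> $ k $ l \<le> \<Psi> $ k0 $ l0" if "k \<noteq> l"
    using that by (simp, intro Max_ge) auto
qed

lemma alpha_star_ansatz_solution:
  fixes S :: "'k::finite \<Rightarrow> 'n::finite set"
  assumes part: "is_block_partition S" and conn: "is_connectivity \<Psi>"
    and mean: "is_block_mean S \<Psi> M" and wa: "weakly_assortative \<Psi>"
    and u: "unique_max_pair \<Psi> k0 l0" and a: "alpha_star S \<Psi> k0 l0 \<in> {0..1}"
  shows "ansatz_solution S \<Psi> M k0 l0 (alpha_star S \<Psi> k0 l0)"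
proof -
  let ?a = "alpha_star S \<Psi> k0 l0"
  let ?I = "high_blocks \<Psi> k0 l0"
  have sym: "transpose \<Psi> = \<Psi>" using conn by (simp add: is_connectivity_def)
  have swap: "\<Psi> $ l0 $ k0 = \<Psi> $ k0 $ l0" using sym by (rule symmetric_entry)
  note max = unique_max_pairD[OF u sym]
  \<comment> \<open>Weak assortativity puts both blocks of the pair into \<open>?I\<close>: the
    entry of the pair is at most \<open>qstar\<close> at either index, hence below both diagonal
    entries.\<close>
  have "\<Psi> $ k0 $ l0 < \<Psi> $ k0 $ k0" "\<Psi> $ l0 $ k0 < \<Psi> $ l0 $ l0"
    using wa max(1) offdiag_le_qstar[of l0 k0 \<Psi>] offdiag_le_qstar[of k0 l0 \<Psi>]
    unfolding weakly_assortative_def by (metis le_less_trans)+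
  then have kl: "k0 \<in> ?I" "l0 \<in> ?I"
    using swap by (auto simp: high_blocks_def)
  have feas: "sdp2_feasible (min_block S) (ansatz S ?I (pair_coeff k0 l0 ?a) (\<lambda>_. 0))"
    using a by (intro pair_ansatz_feasible[OF part kl max(1)] alpha_star_total[OF part]) auto
  have "ansatz S ?I (pair_coeff k0 l0 ?a) (\<lambda>_. 0) \<in> sdp2_solutions M (min_block S)"
    by (rule pair_ansatz_optimal[OF part mean sym _ feas]) (rule max(2))
  then show ?thesis
    unfolding ansatz_solution_def Let_def
    by (intro exI[of _ "pair_coeff k0 l0 ?a"] exI[of _ "\<lambda>_. 0"])
      (auto simp: ansatz_coeffs_def pair_coeff_def insert_commute)
qed

lemma balanced_card:
  fixes S :: "'k::finite \<Rightarrow> 'n::finite set"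
  assumes "balanced S"
  shows "card (S k) = min_block S"
proof -
  have "card (S l) = card (S k)" for l
    using assms unfolding balanced_def by (metis of_nat_eq_iff)
  then have "range (\<lambda>l. card (S l)) = {card (S k)}"
    by auto
  then show ?thesis by (simp add: min_block_def)
qed

text \<open>All relative sizes are 1, so each term of the sum over \<open>high_blocks\<close>
  vanishes and the sum over the complement counts its blocks.\<close>

lemma balanced_alpha_star:
  fixes S :: "'k::finite \<Rightarrow> 'n::finite set"
  assumes "is_block_partition S" "balanced S"
  shows "alpha_star S \<Psi> k0 l0 =
    1 / 2 * (1 - 1 / real (min_block S)) * real (card {k. \<Psi> $ k $ k < \<Psi> $ k0 $ l0})"
proof -
  have "rel_size S k = 1" for k
    using min_block_pos[OF assms(1)] by (simp add: rel_size_def balanced_card[OF assms(2)])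
  moreover have "- high_blocks \<Psi> k0 l0 = {k. \<Psi> $ k $ k < \<Psi> $ k0 $ l0}"
    by (auto simp: high_blocks_def)
  ultimately show ?thesis by (simp add: alpha_star_def)
qed

section \<open>Nonuniqueness in the balanced case\<close>

lemma not_strongly_assortativeE:
  fixes \<Psi> :: "real ^ 'k ^ 'k::finite"
  assumes K: "CARD('k) \<ge> 2" and ns: "\<not> strongly_assortative \<Psi>"
  obtains k0 l0 k1 where "k0 \<noteq> l0" "\<forall>k l. k \<noteq> l \<longrightarrow> \<Psi> $ k $ l \<le> \<Psi> $ k0 $ l0"
    "\<Psi> $ k1 $ k1 \<le> \<Psi> $ k0 $ l0"
proof -
  have "Max (range (qstar \<Psi>)) \<in> range (qstar \<Psi>)" by (intro Max_in) auto
  then obtain k0 where k0: "Max (range (qstar \<Psi>)) = qstar \<Psi> k0" by blast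
  \<comment> \<open>A second block makes the set under the maximum in \<open>qstar\<close> nonempty,
    so that the maximum is attained.\<close>
  have "\<exists>l. l \<noteq> k0"
  proof (rule ccontr)
    assume "\<not> ?thesis"
    then have "(UNIV :: 'k set) = {k0}" by auto
    then have "CARD('k) = card {k0}" by simp
    then show False using K by simp
  qed
  then have "qstar \<Psi> k0 \<in> {\<Psi> $ k0 $ l | l. l \<noteq> k0}"
    unfolding qstar_def by (intro Max_in) auto
  then obtain l0 where l0: "l0 \<noteq> k0" "qstar \<Psi> k0 = \<Psi> $ k0 $ l0" by blast
  have "Min (range (\<lambda>k. \<Psi> $ k $ k)) \<in> range (\<lambda>k. \<Psi> $ k $ k)" by (intro Min_in) auto
  then obtain k1 where k1: "Min (range (\<lambda>k. \<Psi> $ k $ k)) = \<Psi> $ k1 $ k1" by blast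
  show thesis
  proof (rule that)
    show "k0 \<noteq> l0" using l0 by simp
    show "\<Psi> $ k1 $ k1 \<le> \<Psi> $ k0 $ l0"
      using ns k0 l0 k1 unfolding strongly_assortative_def by simp
    show "\<forall>k l. k \<noteq> l \<longrightarrow> \<Psi> $ k $ l \<le> \<Psi> $ k0 $ l0"
    proof (intro allI impI)
      fix k l :: 'k assume "k \<noteq> l"
      then have "\<Psi> $ k $ l \<le> qstar \<Psi> k" by (intro offdiag_le_qstar) simp
      also have "\<dots> \<le> Max (range (qstar \<Psi>))" by (intro Max_ge) auto
      finally show "\<Psi> $ k $ l \<le> \<Psi> $ k0 $ l0" using k0 l0 by simp
    qed
  qed
qed

text \<open>The maximizing pair may fail to be unique and many blocks may lie below it, so the
  competitor dissolves just one weak block \<open>k1\<close>. This keeps its coefficient in [0, 1],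
  and it only has to match the true cluster matrix, which is optimal under the assumption to be
  refuted.\<close>

lemma true_cluster_not_unique_solution:
  fixes S :: "'k::finite \<Rightarrow> 'n::finite set"
  assumes K: "CARD('k) \<ge> 2" and part: "is_block_partition S" and conn: "is_connectivity \<Psi>"
    and mean: "is_block_mean S \<Psi> M" and wa: "weakly_assortative \<Psi>"
    and bal: "balanced S" and m2: "min_block S \<ge> 2" and ns: "\<not> strongly_assortative \<Psi>"
  shows "sdp2_solutions M (real (min_block S)) \<noteq> {true_cluster S}"
proof
  define m where "m = real (min_block S)"
  let ?b = "block_of S"
  assume "sdp2_solutions M (real (min_block S)) = {true_cluster S}"
  then have sol: "sdp2_solutions M m = {true_cluster S}" by (simp add: m_def)
  obtain k0 l0 k1 where kl: "k0 \<noteq> l0"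
    and max: "\<forall>k l. k \<noteq> l \<longrightarrow> \<Psi> $ k $ l \<le> \<Psi> $ k0 $ l0"
    and k1: "\<Psi> $ k1 $ k1 \<le> \<Psi> $ k0 $ l0"
    using not_strongly_assortativeE[OF K ns] by blast
  have swap: "\<Psi> $ l0 $ k0 = \<Psi> $ k0 $ l0"
    using conn unfolding is_connectivity_def by (blast intro: symmetric_entry)
  have "\<Psi> $ k0 $ l0 < \<Psi> $ k0 $ k0" "\<Psi> $ l0 $ k0 < \<Psi> $ l0 $ l0"
    using wa kl offdiag_le_qstar[of l0 k0 \<Psi>] offdiag_le_qstar[of k0 l0 \<Psi>]
    unfolding weakly_assortative_def by (metis le_less_trans)+
  \<comment> \<open>\<open>k1\<close> differs from \<open>k0\<close> and \<open>l0\<close>: its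
    diagonal entry is at most \<open>\<Psi> $ k0 $ l0\<close>, theirs exceed it.\<close>
  then have in_I: "k0 \<in> -{k1}" "l0 \<in> -{k1}"
    using swap k1 by auto
  \<comment> \<open>Dissolving block \<open>k1\<close> removes \<open>m * m - m\<close> from the
    total sum; spread evenly over the \<open>2 * (m * m)\<close> entries of the pair, this is
    \<open>a\<close>.\<close>
  define a where "a = (1 - 1 / m) / 2"
  have m: "m \<ge> 2" using m2 by (simp add: m_def)
  define X where "X = ansatz S (-{k1}) (pair_coeff k0 l0 a) (\<lambda>_. 0)"
  have n: "real (card (S k)) = m" for k
    using balanced_card[OF bal] by (simp add: m_def)
  have feasX: "sdp2_feasible m X"
    unfolding X_def
  proof (rule pair_ansatz_feasible[OF part in_I kl])
    show "0 \<le> a" "a \<le> 1" using m by (simp_all add: a_def field_simps)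
    have "2 * a * m = m - 1" using m by (simp add: a_def field_simps)
    then have "2 * a * (m * m) = (m - 1) * m" by (metis mult.assoc)
    then show "(\<Sum>k\<in>-{k1}. (real (card (S k)))\<^sup>2)
        + 2 * a * (real (card (S k0)) * real (card (S l0)))
        + (\<Sum>k\<in>-(-{k1}). real (card (S k))) = m * real CARD('n)"
      unfolding card_eq_sum_blocks[OF part, of "-{k1}"] n
      by (simp add: power2_eq_square algebra_simps)
  qed
  have feas0: "sdp2_feasible m (true_cluster S)"
    and opt0: "\<And>Y. sdp2_feasible m Y \<Longrightarrow> mat_inner M Y \<le> mat_inner M (true_cluster S)"
    using sol unfolding sdp2_solutions_def by blast+
  have "mat_inner M (true_cluster S) \<le> mat_inner M X"
  proof (rule feasible_mat_inner_le[OF feasX feas0, where q = "\<Psi> $ k0 $ l0"])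
    fix i j
    have entry: "M $ i $ j = \<Psi> $ ?b i $ ?b j"
      using part mean by (rule block_mean_entry)
    \<comment> \<open>The matrices differ only off the diagonal within block \<open>k1\<close>,
      where 1 drops to 0 under a coefficient at most 0, and on the pair, where the coefficient is
      0.\<close>
    show "(M $ i $ j - \<Psi> $ k0 $ l0) * true_cluster S $ i $ j
        \<le> (M $ i $ j - \<Psi> $ k0 $ l0) * X $ i $ j"
      using k1 swap
      by (auto simp: X_def true_cluster_entry[OF part] ansatz_entry[OF part] pair_coeff_def entry
          doubleton_eq_iff)
  qed
  then have "X \<in> sdp2_solutions M m"
    unfolding sdp2_solutions_def using feasX opt0 order_trans by blast
  then have eq: "X = true_cluster S" using sol by blast
  \<comment> \<open>Two distinct vertices of \<open>S k1\<close> separate the matrices. With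
    singleton blocks \<open>a\<close> would be 0 and both matrices would be the identity.\<close>
  obtain i j where ij: "i \<in> S k1" "j \<in> S k1" "i \<noteq> j"
  proof -
    have "2 \<le> card (S k1)" using m2 balanced_card[OF bal] by simp
    then show thesis
      using that card_le_Suc0_iff_eq[of "S k1"] by fastforce
  qed
  then have "X $ i $ j = 0" "true_cluster S $ i $ j = 1"
    using mem_block_iff[OF part] by (auto simp: X_def ansatz_entry[OF part] true_cluster_entry[OF part])
  then show False using eq by simp
qed

theorem proposition5p1:
  fixes S :: "'k::finite \<Rightarrow> 'n::finite set"
    and \<Psi> :: "real ^ 'k ^ 'k"
    and M :: "real ^ 'n ^ 'n"
    and m :: nat
  assumes K: "CARD('k) \<ge> 2"
    and part: "is_block_partition S"
    and conn: "is_connectivity \<Psi>"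
    and mean: "is_block_mean S \<Psi> M"
    and wa: "weakly_assortative \<Psi>"
    and m: "m = min_block S"
  shows "(\<forall>k0 l0. unique_max_pair \<Psi> k0 l0 \<and> alpha_star S \<Psi> k0 l0 \<in> {0..1} \<longrightarrow>
            ansatz_solution S \<Psi> M k0 l0 (alpha_star S \<Psi> k0 l0))
       \<and> (\<forall>k0 l0. unique_max_pair \<Psi> k0 l0 \<and> balanced S \<and>
            card {k. \<Psi> $ k $ k < \<Psi> $ k0 $ l0} \<le> 2 \<longrightarrow>
            alpha_star S \<Psi> k0 l0
              = 1 / 2 * (1 - 1 / real m) * real (card {k. \<Psi> $ k $ k < \<Psi> $ k0 $ l0}) \<and>
            ansatz_solution S \<Psi> M k0 l0 (alpha_star S \<Psi> k0 l0))
       \<and> (balanced S \<and> m \<ge> 2 \<and> \<not> strongly_assortative \<Psi> \<longrightarrow>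
            sdp2_solutions M (real m) \<noteq> {true_cluster S})"
proof (intro conjI allI impI; (elim conjE)?)
  note solution = alpha_star_ansatz_solution[OF part conn mean wa]
  fix k0 l0
  assume u: "unique_max_pair \<Psi> k0 l0"
  show "ansatz_solution S \<Psi> M k0 l0 (alpha_star S \<Psi> k0 l0)"
    if "alpha_star S \<Psi> k0 l0 \<in> {0..1}"
    using u that by (rule solution)
  assume bal: "balanced S" and c: "card {k. \<Psi> $ k $ k < \<Psi> $ k0 $ l0} \<le> 2"
  let ?c = "real (card {k. \<Psi> $ k $ k < \<Psi> $ k0 $ l0})"
  show eq: "alpha_star S \<Psi> k0 l0 = 1 / 2 * (1 - 1 / real m) * ?c"
    unfolding m by (rule balanced_alpha_star[OF part bal])
  \<comment> \<open>Nonempty blocks give \<open>m \<ge> 1\<close>, so this factor lies in [0, 1];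
    with at most two blocks the product is at most 2 and its half at most 1.\<close>
  have "0 \<le> 1 - 1 / real m" "1 - 1 / real m \<le> 1"
    using min_block_pos[OF part] by (simp_all add: m)
  moreover have "0 \<le> ?c" "?c \<le> 2" using c by simp_all
  ultimately have "0 \<le> (1 - 1 / real m) * ?c" "(1 - 1 / real m) * ?c \<le> 1 * 2"
    by (intro mult_nonneg_nonneg mult_mono; simp)+
  then have "alpha_star S \<Psi> k0 l0 \<in> {0..1}" unfolding eq by simp
  with u show "ansatz_solution S \<Psi> M k0 l0 (alpha_star S \<Psi> k0 l0)" by (rule solution)
next
  assume "balanced S" "2 \<le> m" "\<not> strongly_assortative \<Psi>"
  then show "sdp2_solutions M (real m) \<noteq> {true_cluster S}"
    using true_cluster_not_unique_solution[OF K part conn mean wa] by (simp add: m)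
qed

end
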